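(* Let $(X,d)$ be a compact metric space and $f_{0,\infty}=\{f_n\}_{n=0}^{\infty}$ a sequence of continuous self-maps of $X$. Then the following are equivalent: $(X,f_{0,\infty})$ has shadowing; $(\mathcal K(X),\bar f_{0,\infty})$ has shadowing; $(\mathcal F^1(X),\tilde f_{0,\infty})$ has finite shadowing.
   Context: Induced systems: $\mathcal K(X)$ is the set of nonempty compact subsets of $X$ with the Hausdorff metric $D_X$; $\bar f_{0,\infty}=\{\bar f_n\}$, $\bar f_n(A)=f_n(A)$. For upper semicontinuous $u:X\to[0,1]$ let $[u]_\alpha=\{x:u(x)\ge\alpha\}$ for $\alpha\in(0,1]$ and $[u]_0=\overline{\{x:u(x)>0\}}$. $\mathcal F^1(X)$ is the set of upper semicontinuous $u:X\to[0,1]$ with $[u]_\alpha\in\mathcal K(X)$ for all $\alpha\in[0,1]$, with metric $d_\infty(u,v)=\sup_{\alpha\in(0,1]}D_X([u]_\alpha,[v]_\alpha)$. $\tilde f_{0,\infty}=\{\tilde f_n\}$ where $\tilde f_n(u)(x)=\sup_{z\in f_n^{-1}(x)}u(z)$ if $f_n^{-1}(x)\ne\emptyset$, and $0$ otherwise. Shadowing notions, for a metric space $(Y,\rho)$ with a sequence of continuous self-maps $g_{0,\infty}=\{g_i\}_{i\ge0}$, $g_0^0=\mathrm{id}$, $g_0^n=g_{n-1}\circ\cdots\circ g_0$: a finite or infinite sequence $x_0,x_1,\dots$ in $Y$ is a $\delta$-pseudo orbit if $\rho(g_i(x_i),x_{i+1})<\delta$ for all $i\geq 0$ for which $x_{i+1}$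 is defined; it is $\epsilon$-shadowed by $y\in Y$ if $\rho(g_0^i(y),x_i)<\epsilon$ for all indices $i$ of the sequence. $(Y,g_{0,\infty})$ has shadowing (resp. finite shadowing) if for every $\epsilon>0$ there is $\delta>0$ such that every infinite (resp. every finite) $\delta$-pseudo orbit is $\epsilon$-shadowed by some point of $Y$. *)

theory Defs
  imports "HOL-Analysis.Analysis"
begin

text \<open>
  Shadowing is needed on three different spaces, two of which are sets of subsets of, respectively
  functions on, the base space.  A metric space is therefore given here by a carrier \<open>Y\<close> together
  with a distance \<open>\<rho>\<close>, and a nonautonomous system by a sequence of maps \<open>g\<close> of \<open>Y\<close> to itself.
\<close>

primrec orbit_map :: "(nat \<Rightarrow> 'a \<Rightarrow> 'a) \<Rightarrow> nat \<Rightarrow> 'a \<Rightarrow> 'a" where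
  "orbit_map g 0 = id"
| "orbit_map g (Suc n) = g n \<circ> orbit_map g n"

text \<open>
  The set \<open>I\<close> is the set of indices of the sequence: \<open>UNIV\<close> for an infinite sequence,
  \<open>{..n}\<close> for a finite one \<open>x 0, \<dots>, x n\<close>.  Values of \<open>x\<close> outside \<open>I\<close> are irrelevant.
\<close>

definition pseudo_orbit ::
  "'a set \<Rightarrow> ('a \<Rightarrow> 'a \<Rightarrow> real) \<Rightarrow> (nat \<Rightarrow> 'a \<Rightarrow> 'a) \<Rightarrow> real \<Rightarrow> nat set \<Rightarrow> (nat \<Rightarrow> 'a) \<Rightarrow> bool" where
  "pseudo_orbit Y \<rho> g \<delta> I x \<longleftrightarrow>
     (\<forall>i\<in>I. x i \<in> Y) \<and> (\<forall>i. i \<in> I \<and> Suc i \<in> I \<longrightarrow> \<rho> (g i (x i)) (x (Suc i)) < \<delta>)"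

definition shadowed_by ::
  "('a \<Rightarrow> 'a \<Rightarrow> real) \<Rightarrow> (nat \<Rightarrow> 'a \<Rightarrow> 'a) \<Rightarrow> real \<Rightarrow> nat set \<Rightarrow> (nat \<Rightarrow> 'a) \<Rightarrow> 'a \<Rightarrow> bool" where
  "shadowed_by \<rho> g \<epsilon> I x y \<longleftrightarrow> (\<forall>i\<in>I. \<rho> (orbit_map g i y) (x i) < \<epsilon>)"

definition shadowing :: "'a set \<Rightarrow> ('a \<Rightarrow> 'a \<Rightarrow> real) \<Rightarrow> (nat \<Rightarrow> 'a \<Rightarrow> 'a) \<Rightarrow> bool" where
  "shadowing Y \<rho> g \<longleftrightarrow>
     (\<forall>\<epsilon>>0. \<exists>\<delta>>0. \<forall>x. pseudo_orbit Y \<rho> g \<delta> UNIV x \<longrightarrow> (\<exists>y\<in>Y. shadowed_by \<rho> g \<epsilon> UNIV x y))"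

definition finite_shadowing :: "'a set \<Rightarrow> ('a \<Rightarrow> 'a \<Rightarrow> real) \<Rightarrow> (nat \<Rightarrow> 'a \<Rightarrow> 'a) \<Rightarrow> bool" where
  "finite_shadowing Y \<rho> g \<longleftrightarrow>
     (\<forall>\<epsilon>>0. \<exists>\<delta>>0. \<forall>n x. pseudo_orbit Y \<rho> g \<delta> {..n} x \<longrightarrow> (\<exists>y\<in>Y. shadowed_by \<rho> g \<epsilon> {..n} x y))"


definition hyperspace :: "'a::topological_space set set" where
  "hyperspace = {A. compact A \<and> A \<noteq> {}}"

definition hausdorff_distance :: "'a::metric_space set \<Rightarrow> 'a set \<Rightarrow> real" where
  "hausdorff_distance A B = max (SUP a\<in>A. infdist a B) (SUP b\<in>B. infdist b A)"

definition induced_map :: "('a \<Rightarrow> 'a) \<Rightarrow> 'a set \<Rightarrow> 'a set" where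
  "induced_map h A = h ` A"


definition upper_semicontinuous :: "('a::topological_space \<Rightarrow> real) \<Rightarrow> bool" where
  "upper_semicontinuous u \<longleftrightarrow> (\<forall>x. \<forall>c>u x. \<forall>\<^sub>F y in nhds x. u y < c)"

definition level_set :: "('a::topological_space \<Rightarrow> real) \<Rightarrow> real \<Rightarrow> 'a set" where
  "level_set u \<alpha> = (if \<alpha> = 0 then closure {x. u x > 0} else {x. u x \<ge> \<alpha>})"

definition fuzzy_space :: "('a::topological_space \<Rightarrow> real) set" where
  "fuzzy_space = {u. range u \<subseteq> {0..1} \<and> upper_semicontinuous u \<and>
     (\<forall>\<alpha>\<in>{0..1}. level_set u \<alpha> \<in> hyperspace)}"

definition fuzzy_distance :: "('a::metric_space \<Rightarrow> real) \<Rightarrow> ('a \<Rightarrow> real) \<Rightarrow> real" where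
  "fuzzy_distance u v = (SUP \<alpha>\<in>{0<..1}. hausdorff_distance (level_set u \<alpha>) (level_set v \<alpha>))"

definition fuzzification :: "('a \<Rightarrow> 'a) \<Rightarrow> ('a \<Rightarrow> real) \<Rightarrow> 'a \<Rightarrow> real" where
  "fuzzification h u x = (if h -` {x} \<noteq> {} then SUP z\<in>h -` {x}. u z else 0)"

end

theory Submission
  imports Defs
begin

text \<open>
  A sequence of compact sets \<open>A 0, A 1, \<dots>\<close> is shadowed by the set of all points whose orbit
  stays within \<open>\<epsilon>\<close> of it.  This set is closed, and it is large enough as soon as the base system has
  shadowing: if \<open>A\<close> is a pseudo orbit of the induced system, then through every point of every
  \<open>A k\<close> there is a pseudo orbit of points \<open>x i \<in> A i\<close>.  For a pseudo orbit of fuzzy sets the same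
  construction is applied to each family of \<open>\<alpha>\<close>-level sets.  Upper semicontinuity makes the resulting
  sets depend on \<open>\<alpha>\<close> left-continuously, so they are the level sets of a fuzzy set.  Conversely, points
  embed into both spaces as singletons and their indicators, and on a compact space finite shadowing
  implies shadowing.
\<close>

subsection \<open>Hausdorff distance\<close>

lemma infdist_compact_attained:
  assumes "compact B" "B \<noteq> {}"
  shows "\<exists>b\<in>B. infdist a B = dist a b"
proof -
  have "continuous_on B (dist a)"
    by (intro continuous_intros)
  then obtain b where b: "b \<in> B" "\<And>y. y \<in> B \<Longrightarrow> dist a b \<le> dist a y"
    using continuous_attains_inf[OF assms] by blast
  then have "infdist a B = dist a b"
    using assms by (auto simp: infdist_notempty intro!: cINF_greatest antisym cINF_lower2[of _ B b])
  with b show ?thesis by blast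
qed

lemma bdd_above_infdist:
  assumes "compact A"
  shows "bdd_above ((\<lambda>a. infdist a B) ` A)"
  by (intro bounded_imp_bdd_above compact_imp_bounded compact_continuous_image continuous_intros assms)

lemma infdist_le_hausdorff_distance:
  assumes "A \<in> hyperspace" "B \<in> hyperspace"
  shows "a \<in> A \<Longrightarrow> infdist a B \<le> hausdorff_distance A B"
    and "b \<in> B \<Longrightarrow> infdist b A \<le> hausdorff_distance A B"
proof -
  have "compact A" "compact B"
    using assms by (auto simp: hyperspace_def)
  note bdd = this[THEN bdd_above_infdist]
  show "infdist a B \<le> hausdorff_distance A B" if "a \<in> A"
    unfolding hausdorff_distance_def using that bdd by (intro max.coboundedI1 cSUP_upper)
  show "infdist b A \<le> hausdorff_distance A B" if "b \<in> B"
    unfolding hausdorff_distance_def using that bdd by (intro max.coboundedI2 cSUP_upper)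
qed

text \<open>Compactness turns \<open>infdist\<close> into the distance to an actual point, so the
  strict bound is inherited by a pair of points.\<close>

lemma hausdorff_distance_lessD:
  assumes "A \<in> hyperspace" "B \<in> hyperspace" "hausdorff_distance A B < \<delta>"
  shows "a \<in> A \<Longrightarrow> \<exists>b\<in>B. dist a b < \<delta>"
    and "b \<in> B \<Longrightarrow> \<exists>a\<in>A. dist a b < \<delta>"
proof -
  have AB: "compact A" "A \<noteq> {}" "compact B" "B \<noteq> {}"
    using assms by (auto simp: hyperspace_def)
  show "\<exists>b\<in>B. dist a b < \<delta>" if "a \<in> A"
  proof -
    obtain b where "b \<in> B" "infdist a B = dist a b"
      using infdist_compact_attained[OF AB(3,4)] by blast
    with infdist_le_hausdorff_distance(1)[OF assms(1,2) that] assms(3) show ?thesis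
      by (intro bexI[of _ b]) auto
  qed
  show "\<exists>a\<in>A. dist a b < \<delta>" if "b \<in> B"
  proof -
    obtain a where "a \<in> A" "infdist b A = dist b a"
      using infdist_compact_attained[OF AB(1,2)] by blast
    with infdist_le_hausdorff_distance(2)[OF assms(1,2) that] assms(3) show ?thesis
      by (intro bexI[of _ a]) (auto simp: dist_commute)
  qed
qed

lemma hausdorff_distance_le:
  assumes "A \<noteq> {}" "B \<noteq> {}"
    and "\<And>a. a \<in> A \<Longrightarrow> infdist a B \<le> e" "\<And>b. b \<in> B \<Longrightarrow> infdist b A \<le> e"
  shows "hausdorff_distance A B \<le> e"
  unfolding hausdorff_distance_def using assms by (auto intro!: cSUP_least)

lemma hausdorff_distance_self:
  assumes "A \<noteq> {}"
  shows "hausdorff_distance A A = 0"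
  unfolding hausdorff_distance_def using assms by simp

lemma hausdorff_distance_singletons: "hausdorff_distance {a} {b} = dist a b"
  by (simp add: hausdorff_distance_def infdist_notempty dist_commute)

text \<open>Each of these distances is at most the diameter of the compact space. Hence the real
  supremum in \<open>fuzzy_distance\<close> does bound the distance at every level.\<close>

lemma bdd_above_hausdorff_distance:
  fixes A B :: "'i \<Rightarrow> 'a::metric_space set"
  assumes "compact (UNIV :: 'a set)" "\<And>i. i \<in> I \<Longrightarrow> A i \<noteq> {}" "\<And>i. i \<in> I \<Longrightarrow> B i \<noteq> {}"
  shows "bdd_above ((\<lambda>i. hausdorff_distance (A i) (B i)) ` I)"
proof (rule bdd_aboveI2)
  have "infdist a S \<le> diameter (UNIV :: 'a set)" if "S \<noteq> {}" for a :: 'a and S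
    using that diameter_bounded_bound[OF compact_imp_bounded[OF assms(1)]] infdist_le2 by blast
  then show "hausdorff_distance (A i) (B i) \<le> diameter (UNIV :: 'a set)" if "i \<in> I" for i
    using assms(2,3)[OF that] by (intro hausdorff_distance_le)
qed

subsection \<open>Shadowing\<close>

lemma orbit_map_induced: "orbit_map (\<lambda>n. induced_map (f n)) k A = orbit_map f k ` A"
  by (induction k) (auto simp: induced_map_def image_comp)

lemma continuous_on_orbit_map:
  assumes "\<And>n. continuous_on UNIV (f n)"
  shows "continuous_on UNIV (orbit_map f k)"
proof (induction k)
  case (Suc k)
  then show ?case
    using assms[of k] by (simp add: continuous_on_compose continuous_on_subset del: o_apply)
qed (simp add: id_def)

lemma induced_map_hyperspace:
  assumes "continuous_on UNIV h" "A \<in> hyperspace"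
  shows "induced_map h A \<in> hyperspace"
  using assms by (auto simp: induced_map_def hyperspace_def
      intro: compact_continuous_image continuous_on_subset)

section \<open>Finite versus infinite pseudo orbits\<close>

text \<open>A finite pseudo orbit is prolonged by the true orbit of its last point:
  \<open>maps\<close> keeps it in \<open>Y\<close>, and by \<open>refl\<close> the added steps have
  error 0.\<close>

lemma shadowing_imp_finite_shadowing:
  assumes "shadowing Y \<rho> g"
    and maps: "\<And>n y. y \<in> Y \<Longrightarrow> g n y \<in> Y" and refl: "\<And>y. y \<in> Y \<Longrightarrow> \<rho> y y = 0"
  shows "finite_shadowing Y \<rho> g"
  unfolding finite_shadowing_def
proof (intro allI impI)
  fix \<epsilon> :: real assume "\<epsilon> > 0"
  with assms(1) obtain \<delta> where \<delta>: "\<delta> > 0"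
    and sh: "\<And>x. pseudo_orbit Y \<rho> g \<delta> UNIV x \<Longrightarrow> \<exists>y\<in>Y. shadowed_by \<rho> g \<epsilon> UNIV x y"
    unfolding shadowing_def by blast
  show "\<exists>\<delta>>0. \<forall>n x. pseudo_orbit Y \<rho> g \<delta> {..n} x \<longrightarrow> (\<exists>y\<in>Y. shadowed_by \<rho> g \<epsilon> {..n} x y)"
  proof (intro exI[of _ \<delta>] conjI \<delta> allI impI)
    fix n x assume x: "pseudo_orbit Y \<rho> g \<delta> {..n} x"
    define z where "z = rec_nat (x 0) (\<lambda>i w. if Suc i \<le> n then x (Suc i) else g i w)"
    have z: "z (Suc i) = (if Suc i \<le> n then x (Suc i) else g i (z i))" for i
      by (simp add: z_def)
    have zx: "z i = x i" if "i \<le> n" for i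
      using that by (cases i) (auto simp: z, simp add: z_def)
    have zY: "z i \<in> Y" for i
    proof (induction i)
      case 0
      then show ?case using x zx[of 0] by (auto simp: pseudo_orbit_def)
    next
      case (Suc i)
      then show ?case using x maps by (auto simp: z pseudo_orbit_def)
    qed
    have "\<rho> (g i (z i)) (z (Suc i)) < \<delta>" for i
    proof (cases "Suc i \<le> n")
      case True
      then show ?thesis using x by (simp add: zx pseudo_orbit_def)
    next
      case False
      then show ?thesis using zY maps refl \<delta> by (simp add: z)
    qed
    with zY have "pseudo_orbit Y \<rho> g \<delta> UNIV z"
      by (auto simp: pseudo_orbit_def)
    from sh[OF this] obtain y where "y \<in> Y" "\<And>i. \<rho> (orbit_map g i y) (z i) < \<epsilon>"
      by (auto simp: shadowed_by_def)
    then show "\<exists>y\<in>Y. shadowed_by \<rho> g \<epsilon> {..n} x y"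
      by (intro bexI[of _ y]) (auto simp: shadowed_by_def simp flip: zx)
  qed
qed

text \<open>Points that shadow longer and longer initial segments accumulate by compactness, and
  continuity of each iterate lets the limit shadow the whole sequence.\<close>

lemma finite_shadowing_imp_shadowing:
  fixes f :: "nat \<Rightarrow> 'a::metric_space \<Rightarrow> 'a"
  assumes "compact (UNIV :: 'a set)" "\<And>n. continuous_on UNIV (f n)"
    and "finite_shadowing UNIV dist f"
  shows "shadowing UNIV dist f"
  unfolding shadowing_def
proof (intro allI impI)
  fix \<epsilon> :: real assume "\<epsilon> > 0"
  \<comment> \<open>Half of \<epsilon> is kept in reserve because the limit preserves only the
    non-strict inequality.\<close>
  with assms(3) obtain \<delta> where \<delta>: "\<delta> > 0"
    and sh: "\<And>n x. pseudo_orbit UNIV dist f \<delta> {..n} x \<Longrightarrow> \<exists>y. shadowed_by dist f (\<epsilon>/2) {..n} x y"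
    unfolding finite_shadowing_def by (meson half_gt_zero)
  show "\<exists>\<delta>>0. \<forall>x. pseudo_orbit UNIV dist f \<delta> UNIV x \<longrightarrow> (\<exists>y\<in>UNIV. shadowed_by dist f \<epsilon> UNIV x y)"
  proof (intro exI[of _ \<delta>] conjI \<delta> allI impI)
    fix x assume "pseudo_orbit UNIV dist f \<delta> UNIV x"
    then have "\<exists>y. shadowed_by dist f (\<epsilon>/2) {..n} x y" for n
      by (intro sh) (auto simp: pseudo_orbit_def)
    then obtain y where y: "\<And>n. shadowed_by dist f (\<epsilon>/2) {..n} x (y n)"
      by metis
    obtain l r where r: "strict_mono r" and lim: "(y \<circ> r) \<longlonglongrightarrow> l"
      using assms(1) unfolding compact_def by blast
    have "dist (orbit_map f i l) (x i) < \<epsilon>" for i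
    proof -
      have "(\<lambda>n. orbit_map f i ((y \<circ> r) n)) \<longlonglongrightarrow> orbit_map f i l"
        using continuous_on_tendsto_compose[OF continuous_on_orbit_map[of f, OF assms(2)] lim] by simp
      then have "(\<lambda>n. dist (orbit_map f i ((y \<circ> r) n)) (x i)) \<longlonglongrightarrow> dist (orbit_map f i l) (x i)"
        by (intro tendsto_intros)
      moreover have "dist (orbit_map f i ((y \<circ> r) n)) (x i) \<le> \<epsilon>/2" if "n \<ge> i" for n
      proof -
        \<comment> \<open>The index \<open>i\<close> thus lies in the segment \<open>{..r n}\<close>
          that \<open>y (r n)\<close> shadows.\<close>
        from that have "i \<le> r n" using seq_suble[OF r, of n] by simp
        then show ?thesis using y[of "r n"] by (auto simp: shadowed_by_def intro: less_imp_le)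
      qed
      ultimately have "dist (orbit_map f i l) (x i) \<le> \<epsilon>/2"
        by (intro LIMSEQ_le_const2) auto
      with \<open>\<epsilon> > 0\<close> show ?thesis by simp
    qed
    then show "\<exists>y\<in>UNIV. shadowed_by dist f \<epsilon> UNIV x y"
      by (auto simp: shadowed_by_def)
  qed
qed

section \<open>Sets that shadow a sequence of compact sets\<close>

text \<open>For nonempty \<open>A i\<close> this is the largest set whose image at each time
  \<open>i\<close> stays in the closed \<open>e\<close>-neighbourhood of \<open>A i\<close>. The
  non-strict inequality makes it closed.\<close>

definition shadow_set ::
  "(nat \<Rightarrow> 'a::metric_space \<Rightarrow> 'a) \<Rightarrow> real \<Rightarrow> (nat \<Rightarrow> 'a set) \<Rightarrow> 'a set" where
  "shadow_set f e A = {y. \<forall>i. infdist (orbit_map f i y) (A i) \<le> e}"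

lemma closed_shadow_set:
  assumes "\<And>n. continuous_on UNIV (f n)"
  shows "closed (shadow_set f e A)"
  unfolding shadow_set_def
  by (intro closed_Collect_all closed_Collect_le continuous_intros continuous_on_orbit_map assms)

text \<open>Predecessors of \<open>a\<close> are chosen by \<open>bwd\<close> down to index 0,
  successors by \<open>fwd\<close>. The induction on \<open>k\<close> performs the backward choice:
  a pseudo orbit through a predecessor of \<open>a\<close> is kept up to that point and then
  redirected to \<open>a\<close>.\<close>

lemma pseudo_orbit_through:
  assumes fwd: "\<And>i a. a \<in> A i \<Longrightarrow> \<exists>b\<in>A (Suc i). dist (f i a) b < \<delta>"
    and bwd: "\<And>i b. b \<in> A (Suc i) \<Longrightarrow> \<exists>a\<in>A i. dist (f i a) b < \<delta>"
    and "a \<in> A k"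
  shows "\<exists>x. x k = a \<and> (\<forall>i. x i \<in> A i) \<and> pseudo_orbit UNIV dist f \<delta> UNIV x"
  using \<open>a \<in> A k\<close>
proof (induction k arbitrary: a)
  case 0
  have "\<exists>x. \<forall>i. (x i \<in> A i \<and> (i = 0 \<longrightarrow> x i = a)) \<and> dist (f i (x i)) (x (Suc i)) < \<delta>"
    by (rule dependent_nat_choice) (use 0 fwd in auto)
  then show ?case by (auto simp: pseudo_orbit_def)
next
  case (Suc k)
  from bwd[OF Suc.prems] obtain b where b: "b \<in> A k" "dist (f k b) a < \<delta>" by blast
  from Suc.IH[OF b(1)] obtain x where x: "x k = b" "\<forall>i. x i \<in> A i"
    "pseudo_orbit UNIV dist f \<delta> UNIV x" by blast
  \<comment> \<open>The two implications freeze \<open>x\<close> up to \<open>k\<close> and force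
    \<open>a\<close> at \<open>Suc k\<close>. The old tail of \<open>x\<close> may miss
    \<open>a\<close>, so dependent choice builds a new one from \<open>fwd\<close>.\<close>
  have "\<exists>z. \<forall>i. (z i \<in> A i \<and> (i \<le> k \<longrightarrow> z i = x i) \<and> (i = Suc k \<longrightarrow> z i = a)) \<and>
      dist (f i (z i)) (z (Suc i)) < \<delta>"
  proof (rule dependent_nat_choice)
    fix y i assume y: "y \<in> A i \<and> (i \<le> k \<longrightarrow> y = x i) \<and> (i = Suc k \<longrightarrow> y = a)"
    consider "i < k" | "i = k" | "i > k" by linarith
    then show "\<exists>w. (w \<in> A (Suc i) \<and> (Suc i \<le> k \<longrightarrow> w = x (Suc i)) \<and> (Suc i = Suc k \<longrightarrow> w = a)) \<and>
      dist (f i y) w < \<delta>"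
    proof cases
      case 1
      with x y show ?thesis by (auto simp: pseudo_orbit_def)
    next
      case 2
      with x y b Suc.prems show ?thesis by auto
    next
      case 3
      with y fwd show ?thesis by auto
    qed
  qed (use x in auto)
  then show ?case by (auto simp: pseudo_orbit_def)
qed

text \<open>That the images stay close to \<open>A k\<close> is built into
  \<open>shadow_set\<close>; the reverse closeness and nonemptiness come from
  \<open>thru\<close>.\<close>

lemma shadow_set:
  fixes f :: "nat \<Rightarrow> 'a::metric_space \<Rightarrow> 'a"
  assumes "compact (UNIV :: 'a set)" and cont: "\<And>n. continuous_on UNIV (f n)"
    and sh: "\<And>x. pseudo_orbit UNIV dist f \<delta> UNIV x \<Longrightarrow> \<exists>y. shadowed_by dist f e UNIV x y"
    and A: "\<And>i. A i \<in> hyperspace"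
    and po: "\<And>i. hausdorff_distance (f i ` A i) (A (Suc i)) < \<delta>"
  shows "shadow_set f e A \<in> hyperspace"
    and "hausdorff_distance (orbit_map f k ` shadow_set f e A) (A k) \<le> e"
proof -
  have fA: "f i ` A i \<in> hyperspace" for i
    using induced_map_hyperspace[OF cont A] by (simp add: induced_map_def)
  \<comment> \<open>A pseudo orbit through \<open>a\<close> inside the sets \<open>A i\<close> is
    shadowed by some point. As every \<open>x i\<close> lies in \<open>A i\<close>, that point
    belongs to the shadow set, and at time \<open>k\<close> it is near \<open>a\<close>.\<close>
  have thru: "\<exists>y\<in>shadow_set f e A. dist (orbit_map f k y) a < e" if a: "a \<in> A k" for a k
  proof -
    have "\<exists>x. x k = a \<and> (\<forall>i. x i \<in> A i) \<and> pseudo_orbit UNIV dist f \<delta> UNIV x"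
      using hausdorff_distance_lessD[OF fA A po] a by (intro pseudo_orbit_through) blast+
    then obtain x where x: "x k = a" "\<And>i. x i \<in> A i" "pseudo_orbit UNIV dist f \<delta> UNIV x"
      by blast
    obtain y where y: "\<And>i. dist (orbit_map f i y) (x i) < e"
      using sh[OF x(3)] by (auto simp: shadowed_by_def)
    then have "y \<in> shadow_set f e A"
      using x(2) by (auto simp: shadow_set_def intro: infdist_le2 less_imp_le)
    then show ?thesis using y[of k] x(1) by auto
  qed
  have ne: "A i \<noteq> {}" for i using A[of i] by (simp add: hyperspace_def)
  then have ne': "shadow_set f e A \<noteq> {}" using thru[of _ 0] by blast
  moreover have "compact (shadow_set f e A)"
    using compact_Int_closed[OF assms(1) closed_shadow_set[OF cont]] by simp
  ultimately show "shadow_set f e A \<in> hyperspace" by (simp add: hyperspace_def)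
  show "hausdorff_distance (orbit_map f k ` shadow_set f e A) (A k) \<le> e"
  proof (rule hausdorff_distance_le)
    show "infdist a (orbit_map f k ` shadow_set f e A) \<le> e" if "a \<in> A k" for a
      using thru[OF that] by (auto simp: dist_commute intro: infdist_le2 less_imp_le)
  qed (use ne ne' in \<open>auto simp: shadow_set_def\<close>)
qed

lemma shadowing_hyperspace_iff:
  fixes f :: "nat \<Rightarrow> 'a::metric_space \<Rightarrow> 'a"
  assumes "compact (UNIV :: 'a set)" "\<And>n. continuous_on UNIV (f n)"
  shows "shadowing UNIV dist f \<longleftrightarrow>
    shadowing hyperspace hausdorff_distance (\<lambda>n. induced_map (f n))" (is "?X \<longleftrightarrow> ?K")
proof
  assume ?X
  show ?K unfolding shadowing_def
  proof (intro allI impI)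
    fix \<epsilon> :: real assume "\<epsilon> > 0"
    with \<open>?X\<close> obtain \<delta> where \<delta>: "\<delta> > 0"
      and sh: "\<And>x. pseudo_orbit UNIV dist f \<delta> UNIV x \<Longrightarrow> \<exists>y. shadowed_by dist f (\<epsilon>/2) UNIV x y"
      unfolding shadowing_def by (meson half_gt_zero)
    show "\<exists>\<delta>>0. \<forall>A. pseudo_orbit hyperspace hausdorff_distance (\<lambda>n. induced_map (f n)) \<delta> UNIV A \<longrightarrow>
      (\<exists>S\<in>hyperspace. shadowed_by hausdorff_distance (\<lambda>n. induced_map (f n)) \<epsilon> UNIV A S)"
    proof (intro exI[of _ \<delta>] conjI \<delta> allI impI)
      fix A assume "pseudo_orbit hyperspace hausdorff_distance (\<lambda>n. induced_map (f n)) \<delta> UNIV A"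
      then have "\<And>i. A i \<in> hyperspace" "\<And>i. hausdorff_distance (f i ` A i) (A (Suc i)) < \<delta>"
        by (auto simp: pseudo_orbit_def induced_map_def)
      note S = shadow_set[OF assms sh this]
      have "hausdorff_distance (orbit_map f k ` shadow_set f (\<epsilon>/2) A) (A k) < \<epsilon>" for k
        using S(2)[of k] \<open>\<epsilon> > 0\<close> by simp
      with S(1) show "\<exists>S\<in>hyperspace.
          shadowed_by hausdorff_distance (\<lambda>n. induced_map (f n)) \<epsilon> UNIV A S"
        by (auto simp: shadowed_by_def orbit_map_induced)
    qed
  qed
next
  assume ?K
  show ?X unfolding shadowing_def
  proof (intro allI impI)
    fix \<epsilon> :: real assume "\<epsilon> > 0"
    with \<open>?K\<close> obtain \<delta> where \<delta>: "\<delta> > 0" and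
      sh: "\<And>A. pseudo_orbit hyperspace hausdorff_distance (\<lambda>n. induced_map (f n)) \<delta> UNIV A \<Longrightarrow>
        \<exists>S\<in>hyperspace. shadowed_by hausdorff_distance (\<lambda>n. induced_map (f n)) \<epsilon> UNIV A S"
      unfolding shadowing_def by blast
    show "\<exists>\<delta>>0. \<forall>x. pseudo_orbit UNIV dist f \<delta> UNIV x \<longrightarrow> (\<exists>y\<in>UNIV. shadowed_by dist f \<epsilon> UNIV x y)"
    proof (intro exI[of _ \<delta>] conjI \<delta> allI impI)
      fix x assume "pseudo_orbit UNIV dist f \<delta> UNIV x"
      then have "pseudo_orbit hyperspace hausdorff_distance (\<lambda>n. induced_map (f n)) \<delta> UNIV (\<lambda>i. {x i})"
        by (auto simp: pseudo_orbit_def induced_map_def hausdorff_distance_singletons hyperspace_def)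
      from sh[OF this] obtain S where S: "S \<in> hyperspace"
        and d: "\<And>i. hausdorff_distance (orbit_map f i ` S) {x i} < \<epsilon>"
        by (auto simp: shadowed_by_def orbit_map_induced)
      \<comment> \<open>Any point of \<open>S\<close> will do: a Hausdorff distance to a singleton
        controls every point of the image.\<close>
      from S obtain y where y: "y \<in> S" by (auto simp: hyperspace_def)
      have "orbit_map f i ` S \<in> hyperspace" for i
        using induced_map_hyperspace[OF continuous_on_orbit_map[OF assms(2)] S]
        by (simp add: induced_map_def)
      then have "dist (orbit_map f i y) (x i) < \<epsilon>" for i
        using hausdorff_distance_lessD(1)[OF _ _ d, of i "orbit_map f i y"] y
        by (auto simp: hyperspace_def)
      then show "\<exists>y\<in>UNIV. shadowed_by dist f \<epsilon> UNIV x y"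
        by (auto simp: shadowed_by_def)
    qed
  qed
qed

subsection \<open>Level sets of fuzzy sets\<close>

lemma upper_semicontinuous_iff_closed:
  "upper_semicontinuous u \<longleftrightarrow> (\<forall>c. closed {x. u x \<ge> c})"
proof -
  have "{x. u x \<ge> c} = - {x. u x < c}" for c by auto
  then have "closed {x. u x \<ge> c} \<longleftrightarrow> open {x. u x < c}" for c
    by (metis closed_Compl open_closed)
  moreover have "open {x. u x < c} \<longleftrightarrow> (\<forall>x. u x < c \<longrightarrow> (\<forall>\<^sub>F y in nhds x. u y < c))" for c
    by (subst open_subopen) (auto simp: eventually_nhds subset_eq)
  ultimately show ?thesis by (auto simp: upper_semicontinuous_def)
qed

text \<open>The remaining superlevel sets are the whole space or empty, and the closed support is
  compact and contains the nonempty level 1.\<close>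

lemma fuzzy_spaceI:
  fixes u :: "'a::t2_space \<Rightarrow> real"
  assumes "compact (UNIV :: 'a set)" "range u \<subseteq> {0..1}"
    and lev: "\<And>\<alpha>. \<alpha> \<in> {0<..1} \<Longrightarrow> level_set u \<alpha> \<in> hyperspace"
  shows "u \<in> fuzzy_space"
proof -
  have bnd: "0 \<le> u x" "u x \<le> 1" for x using assms(2) by (simp_all add: image_subset_iff)
  have "closed {x. u x \<ge> c}" for c
  proof -
    consider "c \<le> 0" | "c \<in> {0<..1}" | "c > 1" by force
    then show ?thesis
    proof cases
      case 1
      then have "{x. u x \<ge> c} = UNIV" using bnd(1) by (auto intro: order_trans)
      then show ?thesis by simp
    next
      case 2
      with lev[OF 2] show ?thesis by (auto simp: level_set_def hyperspace_def compact_imp_closed)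
    next
      case 3
      then have "{x. u x \<ge> c} = {}" using bnd(2) by (auto simp: not_le intro: le_less_trans)
      then show ?thesis by simp
    qed
  qed
  moreover have "level_set u 0 \<in> hyperspace"
  proof -
    have "{x. u x \<ge> 1} \<noteq> {}"
      using lev[of 1] by (simp add: level_set_def hyperspace_def)
    then have "{x. u x > 0} \<noteq> {}"
      using less_le_trans[OF zero_less_one] by blast
    moreover have "compact (closure {x. u x > 0})"
      using compact_Int_closed[OF assms(1) closed_closure] by simp
    ultimately show ?thesis by (auto simp: level_set_def hyperspace_def)
  qed
  then have "level_set u \<alpha> \<in> hyperspace" if "\<alpha> \<in> {0..1}" for \<alpha>
    using lev[of \<alpha>] that by (cases "\<alpha> = 0") auto
  ultimately show ?thesis
    using assms(2) by (auto simp: fuzzy_space_def upper_semicontinuous_iff_closed)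
qed

text \<open>The superlevel sets of \<open>u\<close> in \<open>K\<close> are nested, compact and
  nonempty below \<alpha>, so their intersection is nonempty. The proof phrases this with open
  covers.\<close>

lemma upper_semicontinuous_attains:
  assumes "upper_semicontinuous u" "compact K"
    and "\<And>\<beta>. \<beta> < \<alpha> \<Longrightarrow> \<exists>z\<in>K. u z \<ge> \<beta>"
  shows "\<exists>z\<in>K. u z \<ge> \<alpha>"
proof (rule ccontr)
  assume "\<not> ?thesis"
  then have "K \<subseteq> (\<Union>\<beta>\<in>{..<\<alpha>}. {z. u z < \<beta>})"
    by (auto simp: not_le dest: dense)
  moreover have "open {z. u z < \<beta>}" for \<beta>
  proof -
    have "{z. u z < \<beta>} = - {z. u z \<ge> \<beta>}" by auto
    then show ?thesis using assms(1) by (simp add: upper_semicontinuous_iff_closed open_Compl)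
  qed
  ultimately obtain D where D: "D \<subseteq> {..<\<alpha>}" "finite D" "K \<subseteq> (\<Union>\<beta>\<in>D. {z. u z < \<beta>})"
    using compactE_image[OF assms(2), of "{..<\<alpha>}" "\<lambda>\<beta>. {z. u z < \<beta>}"] by metis
  \<comment> \<open>Inserting \<open>\<alpha> - 1\<close> gives \<open>Max\<close> a nonempty set
    while keeping \<open>m\<close> below \<alpha>. A point with \<open>u z \<ge> m\<close> then
    escapes the finite subcover.\<close>
  define m where "m = Max (insert (\<alpha> - 1) D)"
  have "m < \<alpha>" using D by (auto simp: m_def)
  then obtain z where "z \<in> K" "u z \<ge> m" using assms(3) by blast
  with D obtain \<beta> where "\<beta> \<in> D" "u z < \<beta>" by blast
  moreover from this have "\<beta> \<le> m" using D(2) by (simp add: m_def)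
  ultimately show False using \<open>u z \<ge> m\<close> by simp
qed

lemma
  assumes "u \<in> fuzzy_space"
  shows fuzzy_space_bounds: "0 \<le> u x" "u x \<le> 1"
    and fuzzy_space_usc: "upper_semicontinuous u"
    and fuzzy_space_level_set: "\<alpha> \<in> {0<..1} \<Longrightarrow> level_set u \<alpha> \<in> hyperspace"
  using assms by (auto simp: fuzzy_space_def image_subset_iff)

text \<open>The closed ball around \<open>z\<close> is compact and contains points of all levels
  below \<alpha>, hence by semicontinuity also a point of level \<alpha>.\<close>

lemma infdist_level_set_left_continuous:
  fixes u :: "'a::metric_space \<Rightarrow> real"
  assumes "compact (UNIV :: 'a set)" "u \<in> fuzzy_space" "\<alpha> \<in> {0<..1}"
    and le: "\<And>\<beta>. 0 < \<beta> \<Longrightarrow> \<beta> < \<alpha> \<Longrightarrow> infdist z (level_set u \<beta>) \<le> e"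
  shows "infdist z (level_set u \<alpha>) \<le> e"
proof -
  have "\<exists>w\<in>cball z e. u w \<ge> \<alpha>"
  proof (rule upper_semicontinuous_attains)
    show "compact (cball z e)"
      using compact_Int_closed[OF assms(1) closed_cball] by simp
    fix \<beta> assume "\<beta> < \<alpha>"
    \<comment> \<open>Since \<beta> may be nonpositive, it is raised to a level in the range where
      \<open>le\<close> applies.\<close>
    define \<gamma> where "\<gamma> = max \<beta> (\<alpha>/2)"
    have \<gamma>: "0 < \<gamma>" "\<gamma> < \<alpha>" "\<beta> \<le> \<gamma>" "\<gamma> \<le> 1"
      using \<open>\<beta> < \<alpha>\<close> assms(3) by (auto simp: \<gamma>_def)
    then have "level_set u \<gamma> \<in> hyperspace"
      using fuzzy_space_level_set[OF assms(2)] by auto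
    then obtain w where "w \<in> level_set u \<gamma>" "infdist z (level_set u \<gamma>) = dist z w"
      using infdist_compact_attained by (auto simp: hyperspace_def)
    with le[OF \<gamma>(1,2)] \<gamma> show "\<exists>w\<in>cball z e. u w \<ge> \<beta>"
      by (intro bexI[of _ w]) (auto simp: level_set_def)
  qed (rule fuzzy_space_usc[OF assms(2)])
  then show ?thesis
    using assms(3) by (auto simp: level_set_def intro: infdist_le2)
qed

text \<open>The representation of fuzzy sets by nested, left-continuous families: the value at a
  point is the supremum of the levels whose set contains it.\<close>

lemma fuzzy_set_of_level_sets:
  fixes C :: "real \<Rightarrow> 'a::t2_space set"
  assumes "compact (UNIV :: 'a set)"
    and C: "\<And>\<alpha>. \<alpha> \<in> {0<..1} \<Longrightarrow> C \<alpha> \<in> hyperspace"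
    and anti: "\<And>\<alpha> \<beta>. 0 < \<alpha> \<Longrightarrow> \<alpha> \<le> \<beta> \<Longrightarrow> \<beta> \<le> 1 \<Longrightarrow> C \<beta> \<subseteq> C \<alpha>"
    and left: "\<And>\<alpha> y. \<alpha> \<in> {0<..1} \<Longrightarrow> (\<And>\<beta>. 0 < \<beta> \<Longrightarrow> \<beta> < \<alpha> \<Longrightarrow> y \<in> C \<beta>) \<Longrightarrow> y \<in> C \<alpha>"
  shows "\<exists>v\<in>fuzzy_space. \<forall>\<alpha>\<in>{0<..1}. level_set v \<alpha> = C \<alpha>"
proof -
  \<comment> \<open>The extra 0 keeps the supremum over a nonempty set and gives value 0 to points
    in no \<open>C \<alpha>\<close>.\<close>
  define T where "T y = insert 0 {\<alpha>\<in>{0<..1}. y \<in> C \<alpha>}" for y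
  define v where "v y = Sup (T y)" for y
  have T: "T y \<noteq> {}" "T y \<subseteq> {0..1}" "bdd_above (T y)" for y
    by (auto simp: T_def intro: bdd_aboveI[of _ 1])
  have range: "range v \<subseteq> {0..1}"
  proof (clarsimp simp: v_def, intro conjI)
    fix y show "0 \<le> Sup (T y)" using T(3) by (intro cSup_upper) (auto simp: T_def)
    show "Sup (T y) \<le> 1" using T(1,2)[of y] by (intro cSup_least) auto
  qed
  have lev: "level_set v \<alpha> = C \<alpha>" if \<alpha>: "\<alpha> \<in> {0<..1}" for \<alpha>
  proof -
    have "v y \<ge> \<alpha>" if "y \<in> C \<alpha>" for y
      unfolding v_def using that \<alpha> T(3) by (intro cSup_upper) (auto simp: T_def)
    moreover have "y \<in> C \<alpha>" if "v y \<ge> \<alpha>" for y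
    proof (rule left[OF \<alpha>])
      fix \<beta> assume \<beta>: "0 < \<beta>" "\<beta> < \<alpha>"
      then have "\<beta> < Sup (T y)" using that by (simp add: v_def)
      then obtain \<gamma> where "\<gamma> \<in> T y" "\<beta> < \<gamma>" using less_cSupE T(1) by metis
      then show "y \<in> C \<beta>" using \<beta> anti[of \<beta> \<gamma>] by (auto simp: T_def)
    qed
    ultimately show ?thesis using \<alpha> by (auto simp: level_set_def)
  qed
  then have "v \<in> fuzzy_space"
    using C by (intro fuzzy_spaceI assms(1) range) auto
  with lev show ?thesis by blast
qed

subsection \<open>Fuzzification\<close>

lemma level_set_fuzzification:
  fixes h :: "'a::metric_space \<Rightarrow> 'a"
  assumes "compact (UNIV :: 'a set)" "continuous_on UNIV h" "u \<in> fuzzy_space" "\<alpha> \<in> {0<..1}"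
  shows "level_set (fuzzification h u) \<alpha> = h ` level_set u \<alpha>"
proof -
  have bdd: "bdd_above (u ` S)" for S
    using fuzzy_space_bounds[OF assms(3)] by (intro bdd_aboveI2)
  have "x \<in> h ` {z. u z \<ge> \<alpha>}" if x: "fuzzification h u x \<ge> \<alpha>" for x
  proof -
    \<comment> \<open>As \<alpha> is positive, the default value 0 cannot reach it, so the fibre is
      nonempty.\<close>
    have ne: "h -` {x} \<noteq> {}" and sup: "(SUP z\<in>h -` {x}. u z) \<ge> \<alpha>"
      using x assms(4) by (auto simp: fuzzification_def split: if_splits)
    have "\<exists>z\<in>h -` {x}. u z \<ge> \<alpha>"
    proof (rule upper_semicontinuous_attains)
      have "closed (h -` {x})"
        using assms(2) by (simp add: continuous_closed_vimage continuous_on_eq_continuous_at)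
      then show "compact (h -` {x})"
        using compact_Int_closed[OF assms(1)] by simp
      fix \<beta> assume "\<beta> < \<alpha>"
      then show "\<exists>z\<in>h -` {x}. u z \<ge> \<beta>"
        using sup less_cSUP_iff[OF ne bdd, of \<beta>] by (meson less_imp_le less_le_trans)
    qed (rule fuzzy_space_usc[OF assms(3)])
    then show ?thesis by auto
  qed
  moreover have "fuzzification h u (h z) \<ge> \<alpha>" if "u z \<ge> \<alpha>" for z
    using that bdd by (auto simp: fuzzification_def intro: cSUP_upper2[where x = z])
  ultimately show ?thesis using assms(4) by (auto simp: level_set_def)
qed

lemma fuzzification_fuzzy_space:
  fixes h :: "'a::metric_space \<Rightarrow> 'a"
  assumes "compact (UNIV :: 'a set)" "continuous_on UNIV h" "u \<in> fuzzy_space"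
  shows "fuzzification h u \<in> fuzzy_space"
proof (rule fuzzy_spaceI)
  note u = fuzzy_space_bounds[OF assms(3)]
  have bdd: "bdd_above (u ` S)" for S
    using u by (intro bdd_aboveI2)
  have "0 \<le> fuzzification h u x \<and> fuzzification h u x \<le> 1" for x
  proof (cases "h -` {x} = {}")
    case False
    then obtain z where "z \<in> h -` {x}" by blast
    then have "0 \<le> (SUP z\<in>h -` {x}. u z)"
      using u bdd by (intro cSUP_upper2) auto
    moreover have "(SUP z\<in>h -` {x}. u z) \<le> 1"
      using False u by (intro cSUP_least) auto
    ultimately show ?thesis using False by (simp add: fuzzification_def)
  qed (simp add: fuzzification_def)
  then show "range (fuzzification h u) \<subseteq> {0..1}" by auto
  show "level_set (fuzzification h u) \<alpha> \<in> hyperspace" if "\<alpha> \<in> {0<..1}" for \<alpha>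
    using induced_map_hyperspace[OF assms(2) fuzzy_space_level_set[OF assms(3) that]]
    by (simp add: level_set_fuzzification[OF assms that] induced_map_def)
qed (rule assms(1))

lemma orbit_map_fuzzification:
  fixes f :: "nat \<Rightarrow> 'a::metric_space \<Rightarrow> 'a"
  assumes "compact (UNIV :: 'a set)" "\<And>n. continuous_on UNIV (f n)" "u \<in> fuzzy_space"
  shows "orbit_map (\<lambda>n. fuzzification (f n)) k u \<in> fuzzy_space"
    and "\<alpha> \<in> {0<..1} \<Longrightarrow>
      level_set (orbit_map (\<lambda>n. fuzzification (f n)) k u) \<alpha> = orbit_map f k ` level_set u \<alpha>"
proof -
  show F: "orbit_map (\<lambda>n. fuzzification (f n)) k u \<in> fuzzy_space" for k
    by (induction k) (auto simp: assms fuzzification_fuzzy_space)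
  show "level_set (orbit_map (\<lambda>n. fuzzification (f n)) k u) \<alpha> = orbit_map f k ` level_set u \<alpha>"
    if "\<alpha> \<in> {0<..1}"
    by (induction k) (auto simp: level_set_fuzzification[OF assms(1,2) F that] image_comp)
qed

lemma hausdorff_distance_le_fuzzy_distance:
  fixes u v :: "'a::metric_space \<Rightarrow> real"
  assumes "compact (UNIV :: 'a set)" "u \<in> fuzzy_space" "v \<in> fuzzy_space" "\<alpha> \<in> {0<..1}"
  shows "hausdorff_distance (level_set u \<alpha>) (level_set v \<alpha>) \<le> fuzzy_distance u v"
  unfolding fuzzy_distance_def
  using fuzzy_space_level_set[OF assms(2)] fuzzy_space_level_set[OF assms(3)]
  by (intro cSUP_upper assms(4) bdd_above_hausdorff_distance assms(1)) (auto simp: hyperspace_def)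

lemma fuzzy_distance_self:
  assumes "u \<in> fuzzy_space"
  shows "fuzzy_distance u u = 0"
proof -
  have "hausdorff_distance (level_set u \<alpha>) (level_set u \<alpha>) = 0" if "\<alpha> \<in> {0<..1}" for \<alpha>
    using fuzzy_space_level_set[OF assms that] by (simp add: hausdorff_distance_self hyperspace_def)
  then have "fuzzy_distance u u = (SUP \<alpha>\<in>{0<..1::real}. 0)"
    unfolding fuzzy_distance_def by (intro SUP_cong refl)
  then show ?thesis by simp
qed

section \<open>Shadowing for fuzzy sets\<close>

text \<open>At each level a fuzzy pseudo orbit is a pseudo orbit of compact sets with the same
  \<delta>. The shadow sets of all levels are assembled into one fuzzy set, which yields shadowing
  of infinite sequences.\<close>

lemma shadowing_fuzzy_space:
  fixes f :: "nat \<Rightarrow> 'a::metric_space \<Rightarrow> 'a"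
  assumes "compact (UNIV :: 'a set)" "\<And>n. continuous_on UNIV (f n)" "shadowing UNIV dist f"
  shows "shadowing fuzzy_space fuzzy_distance (\<lambda>n. fuzzification (f n))"
  unfolding shadowing_def
proof (intro allI impI)
  fix \<epsilon> :: real assume "\<epsilon> > 0"
  with assms(3) obtain \<delta> where \<delta>: "\<delta> > 0"
    and sh: "\<And>x. pseudo_orbit UNIV dist f \<delta> UNIV x \<Longrightarrow> \<exists>y. shadowed_by dist f (\<epsilon>/2) UNIV x y"
    unfolding shadowing_def by (meson half_gt_zero)
  show "\<exists>\<delta>>0. \<forall>u. pseudo_orbit fuzzy_space fuzzy_distance (\<lambda>n. fuzzification (f n)) \<delta> UNIV u \<longrightarrow>
    (\<exists>v\<in>fuzzy_space. shadowed_by fuzzy_distance (\<lambda>n. fuzzification (f n)) \<epsilon> UNIV u v)"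
  proof (intro exI[of _ \<delta>] conjI \<delta> allI impI)
    fix u assume "pseudo_orbit fuzzy_space fuzzy_distance (\<lambda>n. fuzzification (f n)) \<delta> UNIV u"
    then have u: "u i \<in> fuzzy_space"
      and po: "fuzzy_distance (fuzzification (f i) (u i)) (u (Suc i)) < \<delta>" for i
      by (auto simp: pseudo_orbit_def)
    have po': "hausdorff_distance (f i ` level_set (u i) \<alpha>) (level_set (u (Suc i)) \<alpha>) < \<delta>"
      if \<alpha>: "\<alpha> \<in> {0<..1}" for i \<alpha>
      using hausdorff_distance_le_fuzzy_distance[OF assms(1)
          fuzzification_fuzzy_space[OF assms(1,2) u] u \<alpha>, of i i "Suc i"] po[of i]
      by (simp add: level_set_fuzzification[OF assms(1,2) u \<alpha>])
    define C where "C \<alpha> = shadow_set f (\<epsilon>/2) (\<lambda>i. level_set (u i) \<alpha>)" for \<alpha>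
    have S: "C \<alpha> \<in> hyperspace"
      "hausdorff_distance (orbit_map f k ` C \<alpha>) (level_set (u k) \<alpha>) \<le> \<epsilon>/2"
      if \<alpha>: "\<alpha> \<in> {0<..1}" for \<alpha> k
      unfolding C_def
      using shadow_set[where f = f and A = "\<lambda>i. level_set (u i) \<alpha>", OF assms(1,2) sh]
        fuzzy_space_level_set[OF u \<alpha>] po'[OF \<alpha>] by blast+
    have "\<exists>v\<in>fuzzy_space. \<forall>\<alpha>\<in>{0<..1}. level_set v \<alpha> = C \<alpha>"
    proof (rule fuzzy_set_of_level_sets[OF assms(1)])
      show "C \<alpha> \<in> hyperspace" if "\<alpha> \<in> {0<..1}" for \<alpha>
        using S(1) that .
    next
      fix \<alpha> \<beta> :: real assume \<alpha>\<beta>: "0 < \<alpha>" "\<alpha> \<le> \<beta>" "\<beta> \<le> 1"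
      \<comment> \<open>A lower level gives a larger set, which is nearer to every point.\<close>
      have "infdist z (level_set (u i) \<alpha>) \<le> infdist z (level_set (u i) \<beta>)" for z i
        using \<alpha>\<beta> fuzzy_space_level_set[OF u, of \<beta> i]
        by (intro infdist_mono) (auto simp: level_set_def hyperspace_def)
      then show "C \<beta> \<subseteq> C \<alpha>" unfolding C_def shadow_set_def by (blast intro: order_trans)
    next
      fix \<alpha> y assume "\<alpha> \<in> {0<..1}" "\<And>\<beta>. 0 < \<beta> \<Longrightarrow> \<beta> < \<alpha> \<Longrightarrow> y \<in> C \<beta>"
      then show "y \<in> C \<alpha>"
        unfolding C_def shadow_set_def mem_Collect_eq
        by (blast intro: infdist_level_set_left_continuous[OF assms(1) u])
    qed
    then obtain v where v: "v \<in> fuzzy_space" "\<And>\<alpha>. \<alpha> \<in> {0<..1} \<Longrightarrow> level_set v \<alpha> = C \<alpha>" by blast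
    \<comment> \<open>The supremum over levels preserves only a non-strict bound; \<epsilon>/2
      leaves room for the strict one.\<close>
    have "fuzzy_distance (orbit_map (\<lambda>n. fuzzification (f n)) i v) (u i) \<le> \<epsilon>/2" for i
      unfolding fuzzy_distance_def
    proof (rule cSUP_least)
      fix \<alpha> :: real assume \<alpha>: "\<alpha> \<in> {0<..1}"
      show "hausdorff_distance (level_set (orbit_map (\<lambda>n. fuzzification (f n)) i v) \<alpha>)
          (level_set (u i) \<alpha>) \<le> \<epsilon>/2"
        using S(2)[OF \<alpha>, of i] by (simp add: orbit_map_fuzzification(2)[OF assms(1,2) v(1) \<alpha>] v(2)[OF \<alpha>])
    qed simp
    then have "shadowed_by fuzzy_distance (\<lambda>n. fuzzification (f n)) \<epsilon> UNIV u v"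
      using \<open>\<epsilon> > 0\<close> by (simp add: shadowed_by_def le_less_trans[of _ "\<epsilon>/2" \<epsilon>])
    with v(1) show "\<exists>v\<in>fuzzy_space. shadowed_by fuzzy_distance (\<lambda>n. fuzzification (f n)) \<epsilon> UNIV u v"
      by blast
  qed
qed

lemma level_set_indicator: "\<alpha> \<in> {0<..1} \<Longrightarrow> level_set (indicator S) \<alpha> = S"
  by (auto simp: level_set_def indicator_def split: if_splits)

text \<open>Indicators of singletons embed the base space isometrically, and every point of level 1
  of a shadowing fuzzy set shadows the original sequence.\<close>

lemma finite_shadowing_of_fuzzy_space:
  fixes f :: "nat \<Rightarrow> 'a::metric_space \<Rightarrow> 'a"
  assumes "compact (UNIV :: 'a set)" "\<And>n. continuous_on UNIV (f n)"
    and "finite_shadowing fuzzy_space fuzzy_distance (\<lambda>n. fuzzification (f n))"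
  shows "finite_shadowing UNIV dist f"
  unfolding finite_shadowing_def
proof (intro allI impI)
  fix \<epsilon> :: real assume "\<epsilon> > 0"
  with assms(3) obtain \<delta> where \<delta>: "\<delta> > 0"
    and sh: "\<And>n u. pseudo_orbit fuzzy_space fuzzy_distance (\<lambda>n. fuzzification (f n)) \<delta> {..n} u \<Longrightarrow>
      \<exists>v\<in>fuzzy_space. shadowed_by fuzzy_distance (\<lambda>n. fuzzification (f n)) \<epsilon> {..n} u v"
    unfolding finite_shadowing_def by blast
  have ind: "indicator {a} \<in> fuzzy_space" for a :: 'a
    by (intro fuzzy_spaceI assms(1))
      (auto simp: level_set_indicator hyperspace_def indicator_def)
  have one: "(1::real) \<in> {0<..1}" by simp
  show "\<exists>\<delta>>0. \<forall>n x. pseudo_orbit UNIV dist f \<delta> {..n} x \<longrightarrow>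
    (\<exists>y\<in>UNIV. shadowed_by dist f \<epsilon> {..n} x y)"
  proof (intro exI[of _ \<delta>] conjI \<delta> allI impI)
    fix n x assume x: "pseudo_orbit UNIV dist f \<delta> {..n} x"
    \<comment> \<open>Every positive level is a singleton on both sides, so the supremum is over a
      constant.\<close>
    have "fuzzy_distance (fuzzification (f i) (indicator {a})) (indicator {b}) =
        (SUP \<alpha>\<in>{0<..1::real}. dist (f i a) b)" for i a b
      unfolding fuzzy_distance_def
      by (intro SUP_cong refl) (simp add: level_set_fuzzification[OF assms(1,2) ind]
          level_set_indicator hausdorff_distance_singletons del: greaterThanAtMost_iff)
    with x have "pseudo_orbit fuzzy_space fuzzy_distance (\<lambda>n. fuzzification (f n)) \<delta> {..n}
        (\<lambda>i. indicator {x i})"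
      by (auto simp: pseudo_orbit_def ind)
    from sh[OF this] obtain v where v: "v \<in> fuzzy_space"
      and d: "\<And>i. i \<le> n \<Longrightarrow>
        fuzzy_distance (orbit_map (\<lambda>n. fuzzification (f n)) i v) (indicator {x i}) < \<epsilon>"
      by (auto simp: shadowed_by_def)
    obtain y where y: "y \<in> level_set v 1"
      using fuzzy_space_level_set[OF v one] by (auto simp: hyperspace_def)
    have "dist (orbit_map f i y) (x i) < \<epsilon>" if "i \<le> n" for i
    proof -
      note o = orbit_map_fuzzification[where f = f and k = i, OF assms(1,2) v]
      have H: "orbit_map f i ` level_set v 1 \<in> hyperspace" "{x i} \<in> hyperspace"
        using fuzzy_space_level_set[OF o(1) one] by (simp_all add: o(2)[OF one] hyperspace_def)
      have "hausdorff_distance (orbit_map f i ` level_set v 1) {x i} < \<epsilon>"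
        using hausdorff_distance_le_fuzzy_distance[OF assms(1) o(1) ind one, of "x i"] d[OF that]
        by (simp add: o(2)[OF one] level_set_indicator)
      from hausdorff_distance_lessD(1)[OF H this, of "orbit_map f i y"] y show ?thesis by auto
    qed
    then show "\<exists>y\<in>UNIV. shadowed_by dist f \<epsilon> {..n} x y"
      by (auto simp: shadowed_by_def)
  qed
qed

theorem theorem4p2:
  fixes f :: "nat \<Rightarrow> 'a::metric_space \<Rightarrow> 'a"
  assumes "compact (UNIV :: 'a set)"
    and "\<And>n. continuous_on UNIV (f n)"
  shows "(shadowing UNIV dist f \<longleftrightarrow>
            shadowing hyperspace hausdorff_distance (\<lambda>n. induced_map (f n))) \<and>
         (shadowing hyperspace hausdorff_distance (\<lambda>n. induced_map (f n)) \<longleftrightarrow>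
            finite_shadowing fuzzy_space fuzzy_distance (\<lambda>n. fuzzification (f n)))"
proof -
  \<comment> \<open>The fuzzy system has shadowing even for infinite sequences; finite shadowing
    follows by prolongation.\<close>
  have "finite_shadowing fuzzy_space fuzzy_distance (\<lambda>n. fuzzification (f n))"
    if "shadowing UNIV dist f"
    using shadowing_fuzzy_space[OF assms that]
    by (rule shadowing_imp_finite_shadowing) (auto intro: fuzzification_fuzzy_space assms fuzzy_distance_self)
  moreover have "shadowing UNIV dist f"
    if "finite_shadowing fuzzy_space fuzzy_distance (\<lambda>n. fuzzification (f n))"
    by (intro finite_shadowing_imp_shadowing finite_shadowing_of_fuzzy_space assms that)
  ultimately show ?thesis
    using shadowing_hyperspace_iff[of f, OF assms] by blast
qed

end
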